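(* Let $q$ be a prime power with $q\equiv 3 \pmod{4}$. Then there exists a connected graph $\Gamma$ belonging to the orbital association scheme $\mathrm{GL}(2,q^{2})/\!/\mathrm{GL}(2,q)$ admitting perfect state transfer such that the complement $\overline{\Gamma}$ is not a disjoint union of copies of $K_{2}$.
   Context: Let $G=\mathrm{GL}(2,q^{2})$ and $H=\mathrm{GL}(2,q)$. The permutation character $\mathrm{Ind}_H^G(1)$ is multiplicity-free (a result of Gow), so the $(H,H)$-double cosets of $H$ in $G$ give an association scheme on the set $G/H$ of left cosets: for each double coset $HdH$, the relation matrix $A_d$ is the $G/H\times G/H$ matrix with $A_d(xH,yH)=1$ if $x^{-1}y\in HdH$ and $0$ otherwise. This orbital scheme is denoted $\mathrm{GL}(2,q^{2})/\!/\mathrm{GL}(2,q)$. A graph belongs to the scheme if its adjacency matrix is a sum of some of the matrices $A_d$ with $d\notin H$ (closed under transposition). For a graph $X$ with adjacency matrix $A$, the continuous-time quantum walk is $U(\tau)=\exp(-i\tau A)$; perfect state transfer (PST) from vertex $a$ to vertex $b$ at time $\tau$ means $U(\tau)e_a=\gamma e_b$ for some complex $\gamma$ with $|\gamma|=1$. *)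

theory Defs
  imports
    "HOL-Analysis.Analysis"
    "HOL-Algebra.Left_Coset"
    "HOL-Number_Theory.Number_Theory"
    "Graph_Theory.Graph_Theory"
begin

section \<open>General linear groups over a subfield\<close>

definition is_subfield :: "'a::field set \<Rightarrow> bool" where
  "is_subfield K \<longleftrightarrow> 0 \<in> K \<and> 1 \<in> K \<and>
     (\<forall>x\<in>K. \<forall>y\<in>K. x + y \<in> K \<and> x * y \<in> K) \<and>
     (\<forall>x\<in>K. - x \<in> K \<and> inverse x \<in> K)"

definition mat2_over :: "'a set \<Rightarrow> ('a^2^2) set" where
  "mat2_over K = {A. \<forall>i j. A $ i $ j \<in> K}"

text \<open>The inverse is required to have its entries in \<open>K\<close> as well: these are the units
  of the ring of matrices over \<open>K\<close>, and \<open>GL2 K\<close> lies inside \<open>GL2 UNIV\<close>.\<close>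

definition GL2 :: "'a::field set \<Rightarrow> ('a^2^2) monoid" where
  "GL2 K = \<lparr> carrier = {A \<in> mat2_over K. \<exists>B \<in> mat2_over K. A ** B = mat 1 \<and> B ** A = mat 1},
             monoid.mult = (**), one = mat 1 \<rparr>"

section \<open>The orbital scheme of a group on the left cosets of a subgroup\<close>

definition double_coset :: "('g, 'm) monoid_scheme \<Rightarrow> 'g set \<Rightarrow> 'g \<Rightarrow> 'g set" where
  "double_coset G H d = H <#>\<^bsub>G\<^esub> (d <#\<^bsub>G\<^esub> H)"

definition orbital_matrix ::
    "('g, 'm) monoid_scheme \<Rightarrow> 'g set \<Rightarrow> 'g \<Rightarrow> 'g set \<Rightarrow> 'g set \<Rightarrow> complex" where
  "orbital_matrix G H d X Y =
     (if \<exists>x\<in>carrier G. \<exists>y\<in>carrier G. X = x <#\<^bsub>G\<^esub> H \<and> Y = y <#\<^bsub>G\<^esub> H \<and>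
           inv\<^bsub>G\<^esub> x \<otimes>\<^bsub>G\<^esub> y \<in> double_coset G H d
      then 1 else 0)"

definition adjacency_matrix :: "'v pair_pre_digraph \<Rightarrow> 'v \<Rightarrow> 'v \<Rightarrow> complex" where
  "adjacency_matrix \<Gamma> a b = (if (a, b) \<in> parcs \<Gamma> then 1 else 0)"

text \<open>\<open>D\<close> is a set of representatives of double cosets. Two distinct elements of \<open>D\<close> cannot
  represent the same double coset, since the sum would then have an entry of at least \<open>2\<close>.\<close>

definition belongs_to_orbital_scheme ::
    "'g set pair_pre_digraph \<Rightarrow> ('g, 'm) monoid_scheme \<Rightarrow> 'g set \<Rightarrow> bool" where
  "belongs_to_orbital_scheme \<Gamma> G H \<longleftrightarrow>
     pair_graph \<Gamma> \<and> pverts \<Gamma> = lcosets\<^bsub>G\<^esub> H \<and>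
     (\<exists>D. finite D \<and> D \<subseteq> carrier G - H \<and>
        (\<forall>d\<in>D. \<exists>d'\<in>D. \<forall>X \<in> lcosets\<^bsub>G\<^esub> H. \<forall>Y \<in> lcosets\<^bsub>G\<^esub> H.
            orbital_matrix G H d' X Y = orbital_matrix G H d Y X) \<and>
        (\<forall>X \<in> lcosets\<^bsub>G\<^esub> H. \<forall>Y \<in> lcosets\<^bsub>G\<^esub> H.
            adjacency_matrix \<Gamma> X Y = (\<Sum>d\<in>D. orbital_matrix G H d X Y)))"

section \<open>Continuous-time quantum walks\<close>

text \<open>Matrices with rows and columns indexed by a finite set \<open>V\<close> are functions of two arguments;
  only their values on \<open>V\<close> matter.\<close>

primrec matrix_power :: "'v set \<Rightarrow> ('v \<Rightarrow> 'v \<Rightarrow> complex) \<Rightarrow> nat \<Rightarrow> 'v \<Rightarrow> 'v \<Rightarrow> complex" where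
  "matrix_power V M 0 = (\<lambda>a b. if a = b then 1 else 0)"
| "matrix_power V M (Suc k) = (\<lambda>a b. \<Sum>c\<in>V. matrix_power V M k a c * M c b)"

definition matrix_exp :: "'v set \<Rightarrow> ('v \<Rightarrow> 'v \<Rightarrow> complex) \<Rightarrow> 'v \<Rightarrow> 'v \<Rightarrow> complex" where
  "matrix_exp V M a b = (\<Sum>k. matrix_power V M k a b / fact k)"

definition quantum_walk :: "'v pair_pre_digraph \<Rightarrow> real \<Rightarrow> 'v \<Rightarrow> 'v \<Rightarrow> complex" where
  "quantum_walk \<Gamma> \<tau> =
     matrix_exp (pverts \<Gamma>) (\<lambda>a b. - (\<i> * complex_of_real \<tau>) * adjacency_matrix \<Gamma> a b)"

definition basis_vector :: "'v \<Rightarrow> 'v \<Rightarrow> complex" where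
  "basis_vector a c = (if c = a then 1 else 0)"

definition perfect_state_transfer ::
    "'v pair_pre_digraph \<Rightarrow> 'v \<Rightarrow> 'v \<Rightarrow> real \<Rightarrow> bool" where
  "perfect_state_transfer \<Gamma> a b \<tau> \<longleftrightarrow>
     (\<exists>\<gamma>::complex. cmod \<gamma> = 1 \<and>
        (\<forall>c\<in>pverts \<Gamma>. (\<Sum>v\<in>pverts \<Gamma>. quantum_walk \<Gamma> \<tau> c v * basis_vector a v)
                         = \<gamma> * basis_vector b c))"

text \<open>Without \<open>a \<noteq> b\<close> every graph would qualify, taking \<open>\<tau> = 0\<close>.\<close>

definition admits_perfect_state_transfer :: "'v pair_pre_digraph \<Rightarrow> bool" where
  "admits_perfect_state_transfer \<Gamma> \<longleftrightarrow>
     (\<exists>a\<in>pverts \<Gamma>. \<exists>b\<in>pverts \<Gamma>. \<exists>\<tau>>0. a \<noteq> b \<and> perfect_state_transfer \<Gamma> a b \<tau>)"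

section \<open>Complements and disjoint unions\<close>

definition graph_complement :: "'v pair_pre_digraph \<Rightarrow> 'v pair_pre_digraph" where
  "graph_complement \<Gamma> =
     \<lparr> pverts = pverts \<Gamma>,
       parcs = {(a, b). a \<in> pverts \<Gamma> \<and> b \<in> pverts \<Gamma> \<and> a \<noteq> b \<and> (a, b) \<notin> parcs \<Gamma>} \<rparr>"

definition disjoint_union_of_K2s :: "'v pair_pre_digraph \<Rightarrow> bool" where
  "disjoint_union_of_K2s \<Gamma> \<longleftrightarrow>
     (\<exists>\<K>. (\<forall>E\<in>\<K>. complete_digraph 2 (with_proj E)) \<and>
          (\<forall>E\<in>\<K>. \<forall>F\<in>\<K>. E \<noteq> F \<longrightarrow> pverts E \<inter> pverts F = {}) \<and>
          pverts \<Gamma> = (\<Union>E\<in>\<K>. pverts E) \<and> parcs \<Gamma> = (\<Union>E\<in>\<K>. parcs E))"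

end

theory Submission
  imports Defs
begin

text \<open>Let \<open>Z\<close> be the centre of \<open>G\<close> and pick a scalar matrix \<open>z\<close> outside \<open>H\<close> with \<open>z\<^sup>2 \<in> H\<close>. Join \<open>xH\<close> and
  \<open>yH\<close> when \<open>x\<inverse>y\<close> lies outside \<open>ZH\<close> or in \<open>zH\<close>. The adjacency matrix is \<open>A = J - E + T\<close>, where
  \<open>E\<close> is the block matrix of the partition into cosets of \<open>ZH\<close>, whose blocks have size
  \<open>m = q + 1\<close>, and \<open>T\<close> is the fixed-point-free involution \<open>xH \<mapsto> xzH\<close>, which preserves the blocks.
  Since \<open>4\<close> divides \<open>m\<close>, and hence the number of vertices, \<open>J\<close> and \<open>E\<close> do not contribute to
  \<open>exp(-i\<pi>A/2)\<close>, which is therefore \<open>exp(-i\<pi>T/2) = -iT\<close>. The complement has valency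
  \<open>m - 2 \<ge> 2\<close>.\<close>

section \<open>Complete multipartite graphs with a matching inside the parts\<close>

text \<open>Isolates the combinatorics from the group. Later \<open>V\<close> is the set of left
  cosets of \<open>H\<close>, \<open>R\<close> says that two of them lie in the same left coset of
  the larger subgroup \<open>N\<close>, and \<open>t\<close> is translation by the central element
  \<open>z\<close>.\<close>

locale block_involution =
  fixes V :: "'v set" and R :: "('v \<times> 'v) set" and t :: "'v \<Rightarrow> 'v" and m :: nat
  assumes finite_V: "finite V"
    and equiv_R: "equiv V R"
    and card_block: "v \<in> V \<Longrightarrow> card (R `` {v}) = m"
    and t_block: "v \<in> V \<Longrightarrow> (v, t v) \<in> R"
    and t_t: "v \<in> V \<Longrightarrow> t (t v) = v"
    and t_neq: "v \<in> V \<Longrightarrow> t v \<noteq> v"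
begin

section \<open>The graph, its connectedness and its complement\<close>

definition block_graph :: "'v pair_pre_digraph" where
  "block_graph = \<lparr>pverts = V, parcs = {(a, b). a \<in> V \<and> b \<in> V \<and> ((a, b) \<notin> R \<or> b = t a)}\<rparr>"

lemma pverts_block_graph [simp]: "pverts block_graph = V"
  by (simp add: block_graph_def)

lemma parcs_block_graph:
  "(a, b) \<in> parcs block_graph \<longleftrightarrow> a \<in> V \<and> b \<in> V \<and> ((a, b) \<notin> R \<or> b = t a)"
  by (simp add: block_graph_def)

lemma R_in_V: "(a, b) \<in> R \<Longrightarrow> a \<in> V \<and> b \<in> V"
  using equiv_R by (auto simp: equiv_def refl_on_def)

lemma R_refl: "a \<in> V \<Longrightarrow> (a, a) \<in> R"
  using equiv_R by (auto simp: equiv_def refl_on_def)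

lemma R_sym: "(a, b) \<in> R \<Longrightarrow> (b, a) \<in> R"
  using equiv_R by (auto simp: equiv_def sym_def)

lemma R_trans: "(a, b) \<in> R \<Longrightarrow> (b, c) \<in> R \<Longrightarrow> (a, c) \<in> R"
  using equiv_R by (auto simp: equiv_def elim: transE)

lemma t_in_V: "v \<in> V \<Longrightarrow> t v \<in> V"
  using t_block R_in_V by blast

lemma t_eq_iff: "a \<in> V \<Longrightarrow> b \<in> V \<Longrightarrow> b = t a \<longleftrightarrow> a = t b"
  using t_t by metis

lemma pair_graph_block_graph: "pair_graph block_graph"
proof
  show "finite (parcs block_graph)"
    by (rule finite_subset[of _ "V \<times> V"]) (auto simp: parcs_block_graph finite_V)
  show "symmetric (with_proj block_graph)"
    using R_sym t_eq_iff by (auto simp: symmetric_def sym_def parcs_block_graph)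
next
  fix e assume "e \<in> parcs block_graph"
  then show "fst e \<noteq> snd e"
    using R_refl t_neq by (cases e) (auto simp: parcs_block_graph dest: sym)
qed (use finite_V in \<open>auto simp: parcs_block_graph\<close>)

text \<open>Vertices of different blocks are adjacent. Two vertices of one block have a common
  neighbour in another block: since \<open>u\<close> and \<open>w\<close> are in different blocks,
  at least one of them lies outside the given one.\<close>

lemma connected_block_graph:
  assumes "u \<in> V" "w \<in> V" "(u, w) \<notin> R"
  shows "Digraph_Component.connected (with_proj block_graph)"
proof -
  interpret pair_graph block_graph by (rule pair_graph_block_graph)
  have reach: "a \<rightarrow>\<^sup>*\<^bsub>with_proj block_graph\<^esub> b" if "a \<in> V" "b \<in> V" for a b
  proof (cases "(a, b) \<in> R")
    case True
    have "(a, u) \<notin> R \<or> (a, w) \<notin> R"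
      using assms(3) R_sym[of a u] R_trans[of u a w] by blast
    then obtain c where c: "c \<in> V" "(a, c) \<notin> R"
      using assms(1,2) by blast
    then have "(c, b) \<notin> R"
      using True R_sym[of c b] R_trans[of a b c] by blast
    then have "(a, c) \<in> parcs block_graph" "(c, b) \<in> parcs block_graph"
      using c that by (auto simp: parcs_block_graph)
    then show ?thesis by (meson reachable_adjI reachable_trans)
  next
    case False
    then show ?thesis using that by (intro reachable_adjI) (auto simp: parcs_block_graph)
  qed
  then show ?thesis
    unfolding connected_def strongly_connected_def
    using assms(1) reachable_mk_symmetricI by auto
qed

text \<open>In the complement \<open>v\<close> is adjacent to all of its block except
  \<open>v\<close> and \<open>t v\<close>, hence to at least m - 2 \<ge> 2 vertices, whereas a
  vertex of a disjoint union of edges has a single neighbour.\<close>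

lemma complement_not_K2s:
  assumes "v \<in> V" "4 \<le> m"
  shows "\<not> disjoint_union_of_K2s (graph_complement block_graph)"
proof
  assume "disjoint_union_of_K2s (graph_complement block_graph)"
  then obtain \<K> where K2: "\<And>E. E \<in> \<K> \<Longrightarrow> complete_digraph 2 (with_proj E)"
    and disj: "\<And>E F. E \<in> \<K> \<Longrightarrow> F \<in> \<K> \<Longrightarrow> E \<noteq> F \<Longrightarrow> pverts E \<inter> pverts F = {}"
    and arcs: "parcs (graph_complement block_graph) = (\<Union>E\<in>\<K>. parcs E)"
    unfolding disjoint_union_of_K2s_def by (elim exE conjE) metis
  have fin: "finite (R `` {v})" using R_in_V by (intro finite_subset[OF _ finite_V]) auto
  have "2 \<le> card (R `` {v} - {v, t v})"
    using assms card_block[of v] card_Diff_subset_Int[of "{v, t v}" "R `` {v}"]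
      card_mono[of "{v, t v}" "R `` {v} \<inter> {v, t v}"] fin
      diff_card_le_card_Diff[of "{v, t v}" "R `` {v}"] card_insert_le_m1[of 2 "{t v}" v]
    by (simp add: t_neq[symmetric])
  then obtain b c where bc: "b \<in> R `` {v} - {v, t v}" "c \<in> R `` {v} - {v, t v}" "b \<noteq> c"
    by (auto simp: card_le_Suc_iff numeral_2_eq_2)
  have arc: "(v, x) \<in> parcs (graph_complement block_graph)" if "x \<in> R `` {v} - {v, t v}" for x
    using that assms(1) R_in_V by (auto simp: graph_complement_def parcs_block_graph)
  from bc arc obtain E F where EF: "E \<in> \<K>" "(v, b) \<in> parcs E" "F \<in> \<K>" "(v, c) \<in> parcs F"
    unfolding arcs by blast
  have ends: "x \<in> pverts E'" "y \<in> pverts E'" if "E' \<in> \<K>" "(x, y) \<in> parcs E'" for E' x y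
    using K2[OF that(1)] that(2) by (auto simp: complete_digraph_pair_def)
  \<comment> \<open>The two edges share the vertex \<open>v\<close>, so disjointness makes them the
    same \<open>K2\<close>, which would then have the three vertices \<open>v\<close>,
    \<open>b\<close>, \<open>c\<close>.\<close>
  have "E = F" using EF ends disj[of E F] by blast
  then have sub: "{v, b, c} \<subseteq> pverts E" using EF ends by blast
  have "finite (pverts E)" "card (pverts E) = 2"
    using K2 EF(1) by (auto simp: complete_digraph_pair_def)
  with card_mono[OF this(1) sub] bc show False by auto
qed

section \<open>Spectral decomposition of the adjacency matrix and the quantum walk\<close>

definition block :: "'v \<Rightarrow> 'v \<Rightarrow> complex" where
  "block a b = of_bool ((a, b) \<in> R)"

definition swap :: "'v \<Rightarrow> 'v \<Rightarrow> complex" where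
  "swap a b = of_bool (b = t a)"

definition eqm :: "'v \<Rightarrow> 'v \<Rightarrow> complex" where
  "eqm a b = of_bool (a = b)"

abbreviation "A \<equiv> adjacency_matrix block_graph"

text \<open>As \<open>t\<close> stays inside blocks, \<open>1 - block a b\<close> and
  \<open>swap a b\<close> are never both 1, so the sum counts no arc twice.\<close>

lemma adjacency_eq:
  assumes "a \<in> V" "b \<in> V"
  shows "A a b = 1 - block a b + swap a b"
  using assms t_block
  by (auto simp: adjacency_matrix_def parcs_block_graph block_def swap_def)

lemma eqm_mult: "a \<in> V \<Longrightarrow> (\<Sum>c\<in>V. eqm a c * A c b) = A a b"
  using finite_V by (simp add: eqm_def of_bool_def if_distrib[of "\<lambda>x. x * _"] cong: if_cong)

text \<open>Multiplying by \<open>swap\<close> on the left replaces row \<open>a\<close> by row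
  \<open>t a\<close>. The rows of J and of \<open>block\<close> agree there because \<open>a\<close>
  and \<open>t a\<close> share a block, and \<open>swap\<close> becomes \<open>eqm\<close> because
  \<open>t\<close> is an involution.\<close>

lemma swap_mult:
  assumes "a \<in> V" "b \<in> V"
  shows "(\<Sum>c\<in>V. swap a c * A c b) = 1 - block a b + eqm a b"
proof -
  have "(\<Sum>c\<in>V. swap a c * A c b) = A (t a) b"
    using finite_V t_in_V[OF assms(1)]
    by (simp add: swap_def of_bool_def if_distrib[of "\<lambda>x. x * _"] cong: if_cong)
  moreover have "block (t a) b = block a b"
    using t_block[OF assms(1)] R_trans[of a "t a" b] R_trans[of "t a" a b] R_sym[of a "t a"]
    by (auto simp: block_def)
  moreover have "swap (t a) b = eqm a b"
    using t_t[OF assms(1)] by (auto simp: swap_def eqm_def)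
  ultimately show ?thesis using assms by (simp add: adjacency_eq t_in_V)
qed

text \<open>In the notation E, T, J of matrices: E J = m J, E E = m E, and E T = E since
  \<open>t\<close> permutes every block.\<close>

lemma block_mult:
  assumes "a \<in> V" "b \<in> V"
  shows "(\<Sum>c\<in>V. block a c * A c b) = of_nat m + (1 - of_nat m) * block a b"
proof -
  have fin: "finite (R `` {a})" using R_in_V by (intro finite_subset[OF _ finite_V]) auto
  have "(\<Sum>c\<in>V. block a c * A c b) = (\<Sum>c\<in>R `` {a}. A c b)"
    using R_in_V finite_V by (intro sum.mono_neutral_cong_right) (auto simp: block_def)
  also have "\<dots> = (\<Sum>c\<in>R `` {a}. 1 - block a b + of_bool (c = t b))"
  proof (rule sum.cong[OF refl])
    fix c assume c: "c \<in> R `` {a}"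
    then have "c \<in> V" using R_in_V by auto
    moreover have "block c b = block a b"
      using c R_trans[of a c b] R_trans[of c a b] R_sym[of a c] by (auto simp: block_def)
    moreover have "swap c b = of_bool (c = t b)"
      using t_eq_iff[OF \<open>c \<in> V\<close> assms(2)] by (simp add: swap_def)
    ultimately show "A c b = 1 - block a b + of_bool (c = t b)"
      using assms by (simp add: adjacency_eq)
  qed
  also have "\<dots> = of_nat m * (1 - block a b) + of_bool (t b \<in> R `` {a})"
    using fin card_block[OF assms(1)] by (simp add: sum.distrib sum.delta of_bool_def)
  also have "t b \<in> R `` {a} \<longleftrightarrow> (a, b) \<in> R"
    using t_block[OF assms(2)] R_trans R_sym by blast
  finally show ?thesis by (simp add: block_def algebra_simps)
qed

text \<open>A vertex is adjacent to everything outside its block and to its partner under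
  \<open>t\<close>. Together with the three preceding products this shows that the span of J, E, T,
  I is closed under right multiplication by A.\<close>

lemma sum_adjacency:
  assumes "b \<in> V"
  shows "(\<Sum>c\<in>V. A c b) = of_nat (card V) - of_nat m + 1"
proof -
  have "(\<Sum>c\<in>V. A c b) = (\<Sum>c\<in>V. 1 - block c b + of_bool (c = t b))"
    using assms t_eq_iff[OF _ assms] by (intro sum.cong refl) (simp add: adjacency_eq swap_def)
  also have "\<dots> = of_nat (card V) - (\<Sum>c\<in>V. block c b) + 1"
    using finite_V t_in_V[OF assms] by (simp add: sum.distrib sum_subtractf sum.delta of_bool_def)
  also have "(\<Sum>c\<in>V. block c b) = (\<Sum>c\<in>R `` {b}. 1)"
    using finite_V R_in_V R_sym by (intro sum.mono_neutral_cong_right) (auto simp: block_def)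
  finally show ?thesis using card_block[OF assms] by simp
qed

text \<open>With \<open>E\<close>, \<open>T\<close> and \<open>I\<close> standing for \<open>block\<close>, \<open>swap\<close> and \<open>eqm\<close>, the spectral idempotents of
  \<open>A\<close> are \<open>J/n\<close>, \<open>E/m - J/n\<close>, \<open>(I + T)/2 - E/m\<close> and \<open>(I - T)/2\<close>, with eigenvalues \<open>n - m + 1\<close>, \<open>1 - m\<close>, \<open>1\<close> and \<open>-1\<close>.\<close>

lemma matrix_power_eq:
  fixes s :: complex
  defines "n \<equiv> of_nat (card V)" and "\<mu> \<equiv> of_nat m"
  assumes "a \<in> V" "b \<in> V"
  shows "matrix_power V (\<lambda>a b. s * A a b) k a b =
    (s * (n - \<mu> + 1)) ^ k * (1 / n) + (s * (1 - \<mu>)) ^ k * (block a b / \<mu> - 1 / n)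
    + s ^ k * ((eqm a b + swap a b) / 2 - block a b / \<mu>) + (- s) ^ k * ((eqm a b - swap a b) / 2)"
  using assms(4)
proof (induction k arbitrary: b)
  \<comment> \<open>The four idempotents sum to the identity matrix.\<close>
  case 0
  then show ?case by (simp add: eqm_def add_divide_distrib diff_divide_distrib)
next
  case (Suc k)
  have "finite (R `` {a})"
    using R_in_V by (intro finite_subset[OF _ finite_V]) auto
  then have "card (R `` {a}) \<noteq> 0" "card V \<noteq> 0"
    using R_refl[OF assms(3)] assms(3) finite_V by auto
  then have nz: "n \<noteq> 0" "\<mu> \<noteq> 0"
    using card_block[OF assms(3)] by (simp_all add: n_def \<mu>_def)
  \<comment> \<open>Naming the powers and the reciprocals turns the induction step into a polynomial
    identity modulo the relations \<open>inv\<close>.\<close>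
  define p1 p2 p3 p4 where p: "p1 = (s * (n - \<mu> + 1)) ^ k" "p2 = (s * (1 - \<mu>)) ^ k"
    "p3 = s ^ k" "p4 = (- s) ^ k"
  define u w h where uwh: "u = 1 / n" "w = 1 / \<mu>" "h = (1 / 2 :: complex)"
  have inv: "n * u = 1" "\<mu> * w = 1" "2 * h = 1"
    using nz by (simp_all add: uwh)
  have divs: "x / n = x * u" "x / \<mu> = x * w" "x / 2 = x * h" for x
    by (simp_all add: uwh)
  have "matrix_power V (\<lambda>a b. s * A a b) (Suc k) a b
     = (\<Sum>c\<in>V. (p1 * (1 / n) + p2 * (block a c / \<mu> - 1 / n)
    + p3 * ((eqm a c + swap a c) / 2 - block a c / \<mu>) + p4 * ((eqm a c - swap a c) / 2)) * (s * A c b))"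
    by (simp add: Suc.IH p)
  also have "\<dots> = (\<Sum>c\<in>V. s * ((p1 - p2) * u) * A c b + s * ((p2 - p3) * w) * (block a c * A c b)
      + s * ((p3 + p4) * h) * (eqm a c * A c b) + s * ((p3 - p4) * h) * (swap a c * A c b))"
    unfolding divs by (intro sum.cong refl) (simp add: algebra_simps)
  also have "\<dots> = s * ((p1 - p2) * u) * (n - \<mu> + 1) + s * ((p2 - p3) * w) * (\<mu> + (1 - \<mu>) * block a b)
      + s * ((p3 + p4) * h) * (1 - block a b + swap a b) + s * ((p3 - p4) * h) * (1 - block a b + eqm a b)"
    using Suc.prems assms(3)
    by (simp only: sum.distrib sum_distrib_left[symmetric] eqm_mult swap_mult block_mult
        sum_adjacency adjacency_eq n_def \<mu>_def)
  \<comment> \<open>The last three summands are multiples of \<open>n * u - 1\<close>,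
    \<open>\<mu> * w - 1\<close> and \<open>2 * h - 1\<close>. With them the equation holds by ring
    arithmetic alone, and \<open>inv\<close> then makes them vanish.\<close>
  also have "\<dots> = (s * (n - \<mu> + 1)) * p1 * u + (s * (1 - \<mu>)) * p2 * (block a b * w - u)
    + s * p3 * ((eqm a b + swap a b) * h - block a b * w) + (- s) * p4 * ((eqm a b - swap a b) * h)
    - s * p2 * (n * u - 1) + s * (p2 - p3 + p3 * block a b) * (\<mu> * w - 1)
    + s * p3 * (1 - block a b) * (2 * h - 1)"
    by (simp add: algebra_simps)
  also have "\<dots> = (s * (n - \<mu> + 1)) * p1 * (1 / n) + (s * (1 - \<mu>)) * p2 * (block a b / \<mu> - 1 / n)
    + s * p3 * ((eqm a b + swap a b) / 2 - block a b / \<mu>) + (- s) * p4 * ((eqm a b - swap a b) / 2)"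
    unfolding divs by (simp add: inv)
  finally show ?case by (simp add: p)
qed

text \<open>Each entry of the k-th power is a sum of four terms of the form z^k x, and each of these
  contributes exp(z) x to the exponential series.\<close>

lemma matrix_exp_eq:
  fixes s :: complex
  defines "n \<equiv> of_nat (card V)" and "\<mu> \<equiv> of_nat m"
  assumes "a \<in> V" "b \<in> V"
  shows "matrix_exp V (\<lambda>a b. s * A a b) a b =
    exp (s * (n - \<mu> + 1)) * (1 / n) + exp (s * (1 - \<mu>)) * (block a b / \<mu> - 1 / n)
    + exp s * ((eqm a b + swap a b) / 2 - block a b / \<mu>) + exp (- s) * ((eqm a b - swap a b) / 2)"
proof -
  have e: "(\<lambda>k. z ^ k * x / fact k) sums (exp z * x)" for z x :: complex
    using sums_mult2[OF exp_converges[of z], of x]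
    by (simp add: scaleR_conv_of_real field_simps)
  show ?thesis
    unfolding matrix_exp_def n_def \<mu>_def matrix_power_eq[OF assms(3,4)] add_divide_distrib
    by (intro sums_unique[symmetric] sums_add e)
qed

text \<open>With n = \<open>card V\<close>, the eigenvalues n - m + 1, 1 - m and 1 are all 1 modulo
  4, so at time \<pi>/2 they share the phase -i, while -1 gets the phase i. The walk is therefore
  -i(I + T)/2 + i(I - T)/2 = -iT.\<close>

lemma perfect_state_transfer_block_graph:
  assumes "v \<in> V" "4 dvd m"
  shows "perfect_state_transfer block_graph v (t v) (pi / 2)"
proof -
  \<comment> \<open>The blocks partition \<open>V\<close> into classes of equal size m.\<close>
  have "m dvd card V"
    using card_block by (intro equiv_imp_dvd_card[OF finite_V equiv_R]) (auto elim!: quotientE)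
  then have "4 dvd card V" using assms(2) by (rule dvd_trans[rotated])
  then obtain l where l: "card V = 4 * l" ..
  obtain j where j: "m = 4 * j" using assms(2) ..
  define s where "s = - (\<i> * complex_of_real (pi / 2))"
  have s: "exp s = - \<i>" "exp (- s) = \<i>"
    by (auto simp: s_def exp_eq_polar cis_conv_exp[symmetric] exp_minus)
  \<comment> \<open>Adding a multiple of 4 to an eigenvalue changes the exponent by a multiple of
    2\<pi>i.\<close>
  have per: "exp (s * (1 + 4 * of_int i)) = - \<i>" for i
  proof -
    have "s * (1 + 4 * of_int i) = s + \<i> * (of_int (- i) * (of_real pi * 2))"
      by (simp add: s_def field_simps)
    then show ?thesis by (simp only: exp_plus_2pin s)
  qed
  have U: "quantum_walk block_graph (pi / 2) c v = - \<i> * swap c v" if "c \<in> V" for c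
  proof -
    have e1: "exp (s * (of_nat (card V) - of_nat m + 1)) = - \<i>"
      using per[of "int l - int j"] by (simp add: l j algebra_simps)
    have e2: "exp (s * (1 - of_nat m)) = - \<i>"
      using per[of "- int j"] by (simp add: j algebra_simps)
    have "matrix_exp V (\<lambda>a b. s * A a b) c v = - \<i> * swap c v"
      unfolding matrix_exp_eq[OF that assms(1)] e1 e2 s
      by (simp add: algebra_simps add_divide_distrib diff_divide_distrib)
    then show ?thesis
      by (simp add: quantum_walk_def s_def)
  qed
  show ?thesis
    unfolding perfect_state_transfer_def pverts_block_graph
  proof (intro exI[of _ "- \<i>"] conjI ballI)
    fix c assume c: "c \<in> V"
    have "(\<Sum>w\<in>V. quantum_walk block_graph (pi / 2) c w * basis_vector v w)
        = quantum_walk block_graph (pi / 2) c v"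
      using finite_V assms(1) by (simp add: basis_vector_def if_distrib sum.delta cong: if_cong)
    also have "\<dots> = - \<i> * basis_vector (t v) c"
      using U[OF c] t_eq_iff[OF c assms(1)] by (simp add: swap_def basis_vector_def)
    finally show "(\<Sum>w\<in>V. quantum_walk block_graph (pi / 2) c w * basis_vector v w)
        = - \<i> * basis_vector (t v) c" .
  qed simp
qed

end

section \<open>Graphs in the orbital scheme of a finite group\<close>

no_notation subset_mset (infix \<open><#\<close> 50)

context group
begin

lemma lcoset_eq_iff:
  assumes "subgroup H G" "x \<in> carrier G" "y \<in> carrier G"
  shows "x <# H = y <# H \<longleftrightarrow> inv x \<otimes> y \<in> H"
proof
  assume "x <# H = y <# H"
  then have "y \<in> x <# H" using lcos_self[OF assms(3,1)] by simp
  then show "inv x \<otimes> y \<in> H"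
    using subgroup.lcos_module_imp[OF assms(1) group_axioms assms(2)] by blast
next
  assume "inv x \<otimes> y \<in> H"
  then have "y \<in> x <# H"
    using subgroup.lcos_module_rev[OF assms(1) group_axioms assms(2,3)] by blast
  then show "x <# H = y <# H" using l_repr_independence[OF _ assms(2,1)] by blast
qed

text \<open>These are the unions of (H,H)-double cosets, the sets that can serve as connection sets
  for graphs on the left cosets of \<open>H\<close>.\<close>

definition bi_invariant :: "'a set \<Rightarrow> 'a set \<Rightarrow> bool" where
  "bi_invariant H S \<longleftrightarrow> S \<subseteq> carrier G \<and> (\<forall>h\<in>H. \<forall>s\<in>S. \<forall>h'\<in>H. h \<otimes> s \<otimes> h' \<in> S)"

text \<open>Passing to other representatives multiplies \<open>inv x \<otimes> y\<close> by elements
  of \<open>H\<close> on both sides. Hence a bi-invariant set defines a relation on left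
  cosets.\<close>

lemma lcoset_rep_indep:
  assumes "subgroup H G" "bi_invariant H S"
    and "x \<in> carrier G" "y \<in> carrier G" "x' \<in> carrier G" "y' \<in> carrier G"
    and "x <# H = x' <# H" "y <# H = y' <# H" "inv x \<otimes> y \<in> S"
  shows "inv x' \<otimes> y' \<in> S"
proof -
  have "inv x' \<otimes> x \<in> H" "inv y \<otimes> y' \<in> H"
    using lcoset_eq_iff assms by metis+
  then have "(inv x' \<otimes> x) \<otimes> (inv x \<otimes> y) \<otimes> (inv y \<otimes> y') \<in> S"
    using assms unfolding bi_invariant_def by blast
  also have "(inv x' \<otimes> x) \<otimes> (inv x \<otimes> y) \<otimes> (inv y \<otimes> y') = inv x' \<otimes> y'"
    using assms(3-6) by (metis (no_types, lifting) inv_closed m_assoc m_closed r_inv r_one)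
  finally show ?thesis .
qed

section \<open>Double cosets as a partition of the group, and their orbital matrices\<close>

lemma double_coset_eq:
  "double_coset G H d = {h \<otimes> (d \<otimes> h') | h h'. h \<in> H \<and> h' \<in> H}"
  by (auto simp: double_coset_def set_mult_def l_coset_def)

lemma double_coset_self:
  assumes "subgroup H G" "d \<in> carrier G"
  shows "d \<in> double_coset G H d"
proof -
  have "d = \<one> \<otimes> (d \<otimes> \<one>)" using assms(2) by simp
  then show ?thesis unfolding double_coset_eq using subgroup.one_closed[OF assms(1)] by blast
qed

lemma bi_invariant_double_coset:
  assumes "subgroup H G" "d \<in> carrier G"
  shows "bi_invariant H (double_coset G H d)"
  unfolding bi_invariant_def
proof (intro conjI ballI)
  have HG: "h \<in> carrier G" if "h \<in> H" for h using that subgroup.mem_carrier[OF assms(1)] by blast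
  show "double_coset G H d \<subseteq> carrier G"
    using HG assms(2) by (auto simp: double_coset_eq)
  fix a s b assume ab: "a \<in> H" "s \<in> double_coset G H d" "b \<in> H"
  then obtain h h' where h: "s = h \<otimes> (d \<otimes> h')" "h \<in> H" "h' \<in> H"
    by (auto simp: double_coset_eq)
  then have "a \<otimes> s \<otimes> b = (a \<otimes> h) \<otimes> (d \<otimes> (h' \<otimes> b))"
    using ab HG assms(2) by (simp add: m_assoc)
  moreover have "a \<otimes> h \<in> H" "h' \<otimes> b \<in> H"
    using h ab subgroup.m_closed[OF assms(1)] by blast+
  ultimately show "a \<otimes> s \<otimes> b \<in> double_coset G H d"
    by (auto simp: double_coset_eq)
qed

lemma double_coset_subset:
  assumes "bi_invariant H S" "s \<in> S" "subgroup H G"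
  shows "double_coset G H s \<subseteq> S"
proof
  fix x assume "x \<in> double_coset G H s"
  then obtain h h' where x: "x = h \<otimes> (s \<otimes> h')" and h: "h \<in> H" "h' \<in> H"
    by (auto simp: double_coset_eq)
  then have "x = h \<otimes> s \<otimes> h'"
    using assms subgroup.mem_carrier[OF assms(3)] by (auto simp: bi_invariant_def m_assoc subsetD)
  then show "x \<in> S" using h assms by (auto simp: bi_invariant_def)
qed

lemma double_coset_sym:
  assumes "subgroup H G" "d \<in> carrier G" "e \<in> double_coset G H d"
  shows "d \<in> double_coset G H e"
proof -
  obtain h h' where e: "e = h \<otimes> (d \<otimes> h')" and h: "h \<in> H" "h' \<in> H"
    using assms(3) by (auto simp: double_coset_eq)
  then have c: "h \<in> carrier G" "h' \<in> carrier G" using subgroup.mem_carrier[OF assms(1)] by blast+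
  then have "d = inv h \<otimes> (e \<otimes> inv h')"
    using assms(2) by (simp add: e m_assoc) (simp add: m_assoc[symmetric])
  then show ?thesis
    unfolding double_coset_eq using h subgroup.m_inv_closed[OF assms(1)] by blast
qed

lemma double_coset_eqI:
  assumes "subgroup H G" "d \<in> carrier G" "e \<in> double_coset G H d"
  shows "double_coset G H e = double_coset G H d"
proof
  have "e \<in> carrier G"
    using assms bi_invariant_double_coset by (auto simp: bi_invariant_def)
  then show "double_coset G H d \<subseteq> double_coset G H e"
    using double_coset_subset[OF bi_invariant_double_coset] double_coset_sym assms by blast
  show "double_coset G H e \<subseteq> double_coset G H d"
    using double_coset_subset[OF bi_invariant_double_coset] assms by blast
qed

text \<open>Inverting the representative transposes the orbital matrix; this gives the closure under
  transposition that the scheme demands.\<close>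

lemma double_coset_inv:
  assumes "subgroup H G" "d \<in> carrier G" "e \<in> double_coset G H d"
  shows "inv e \<in> double_coset G H (inv d)"
proof -
  obtain h h' where e: "e = h \<otimes> (d \<otimes> h')" and h: "h \<in> H" "h' \<in> H"
    using assms(3) by (auto simp: double_coset_eq)
  then have c: "h \<in> carrier G" "h' \<in> carrier G" using subgroup.mem_carrier[OF assms(1)] by blast+
  then have "inv e = inv h' \<otimes> (inv d \<otimes> inv h)"
    using assms(2) by (simp add: e inv_mult_group m_assoc)
  then show ?thesis
    unfolding double_coset_eq using h subgroup.m_inv_closed[OF assms(1)] by blast
qed

lemma orbital_matrix_lcosets:
  assumes "subgroup H G" "d \<in> carrier G" "x \<in> carrier G" "y \<in> carrier G"
  shows "orbital_matrix G H d (x <# H) (y <# H) = of_bool (inv x \<otimes> y \<in> double_coset G H d)"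
proof -
  have "(\<exists>x'\<in>carrier G. \<exists>y'\<in>carrier G. x <# H = x' <# H \<and> y <# H = y' <# H \<and>
      inv x' \<otimes> y' \<in> double_coset G H d) \<longleftrightarrow> inv x \<otimes> y \<in> double_coset G H d"
    using assms(3,4) lcoset_rep_indep[OF assms(1) bi_invariant_double_coset[OF assms(1,2)]]
    by metis
  then show ?thesis by (simp add: orbital_matrix_def)
qed

text \<open>A symmetric union of double cosets that avoids \<open>H\<close> yields a graph of the
  scheme: choose one representative of each double coset inside \<open>S\<close>, so that the
  orbital matrices add up to the indicator of \<open>S\<close>.\<close>

lemma belongs_to_orbital_schemeI:
  assumes fin: "finite (carrier G)" and H: "subgroup H G"
    and S: "bi_invariant H S" "S \<inter> H = {}" "\<And>s. s \<in> S \<Longrightarrow> inv s \<in> S"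
    and \<Gamma>: "pair_graph \<Gamma>" "pverts \<Gamma> = lcosets H"
    and arcs: "\<And>x y. x \<in> carrier G \<Longrightarrow> y \<in> carrier G \<Longrightarrow>
      (x <# H, y <# H) \<in> parcs \<Gamma> \<longleftrightarrow> inv x \<otimes> y \<in> S"
  shows "belongs_to_orbital_scheme \<Gamma> G H"
proof -
  \<comment> \<open>The choice depends only on the double coset as a set, so equal double cosets
    receive the same representative and no orbital matrix is summed twice.\<close>
  define rep where "rep d = (SOME e. e \<in> double_coset G H d)" for d
  have SG: "s \<in> carrier G" if "s \<in> S" for s
    using that S(1) by (auto simp: bi_invariant_def)
  have rep: "rep d \<in> double_coset G H d" if "d \<in> carrier G" for d
    unfolding rep_def using double_coset_self[OF H that] by (rule someI)
  have rep_S: "rep s \<in> S" if "s \<in> S" for s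
    using rep[OF SG[OF that]] double_coset_subset[OF S(1) that H] by blast
  have dc_rep: "double_coset G H (rep d) = double_coset G H d" if "d \<in> carrier G" for d
    using double_coset_eqI[OF H that rep[OF that]] .
  have rep_eq: "rep d = rep e" if "double_coset G H d = double_coset G H e" for d e
    using that by (simp add: rep_def)
  \<comment> \<open>Each \<open>g\<close> lies in the double coset of at most one chosen
    representative, which collapses the sum of orbital matrices to a single term.\<close>
  have mem_dc: "g \<in> double_coset G H d \<longleftrightarrow> d = rep g" if "d \<in> rep ` S" "g \<in> carrier G" for d g
  proof
    obtain s where s: "s \<in> S" "d = rep s" using \<open>d \<in> rep ` S\<close> by blast
    assume "g \<in> double_coset G H d"
    then have "double_coset G H g = double_coset G H s"
      using double_coset_eqI[OF H SG] s dc_rep[OF SG] by metis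
    then show "d = rep g" using rep_eq s by metis
  next
    assume "d = rep g"
    then show "g \<in> double_coset G H d"
      using that dc_rep double_coset_self[OF H] by metis
  qed
  show ?thesis
    unfolding belongs_to_orbital_scheme_def
  proof (intro conjI exI[of _ "rep ` S"] \<Gamma> ballI)
    show fin_rep: "finite (rep ` S)"
      using SG fin by (meson finite_imageI finite_subset subsetI)
    show "rep ` S \<subseteq> carrier G - H"
      using rep_S SG S(2) by blast
  next
    fix d assume "d \<in> rep ` S"
    then have d: "d \<in> S" using rep_S by auto
    show "\<exists>d'\<in>rep ` S. \<forall>X\<in>lcosets H. \<forall>Y\<in>lcosets H.
        orbital_matrix G H d' X Y = orbital_matrix G H d Y X"
    proof (intro bexI ballI)
      show "rep (inv d) \<in> rep ` S" using S(3)[OF d] by blast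
      fix X Y assume "X \<in> lcosets H" "Y \<in> lcosets H"
      then obtain x y where xy: "X = x <# H" "x \<in> carrier G" "Y = y <# H" "y \<in> carrier G"
        by (auto simp: LCOSETS_def)
      have "inv x \<otimes> y \<in> double_coset G H (inv d) \<longleftrightarrow> inv y \<otimes> x \<in> double_coset G H d"
        using double_coset_inv[OF H SG[OF d], of "inv y \<otimes> x"]
          double_coset_inv[OF H inv_closed[OF SG[OF d]], of "inv x \<otimes> y"] xy SG[OF d]
        by (auto simp: inv_mult_group)
      then show "orbital_matrix G H (rep (inv d)) X Y = orbital_matrix G H d Y X"
        using xy d SG rep_S S(3) by (simp add: orbital_matrix_lcosets[OF H] dc_rep)
    qed
  next
    fix X Y assume "X \<in> lcosets H" "Y \<in> lcosets H"
    then obtain x y where xy: "X = x <# H" "x \<in> carrier G" "Y = y <# H" "y \<in> carrier G"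
      by (auto simp: LCOSETS_def)
    define g where "g = inv x \<otimes> y"
    have g: "g \<in> carrier G" using xy by (simp add: g_def)
    have "(\<Sum>d\<in>rep ` S. orbital_matrix G H d X Y) = (\<Sum>d\<in>rep ` S. if d = rep g then 1 else 0)"
    proof (rule sum.cong[OF refl])
      fix d assume d: "d \<in> rep ` S"
      then have "d \<in> carrier G" using rep_S SG by auto
      then show "orbital_matrix G H d X Y = (if d = rep g then 1 else 0)"
        using mem_dc[OF d g] xy by (simp add: orbital_matrix_lcosets[OF H] g_def)
    qed
    also have "\<dots> = of_bool (rep g \<in> rep ` S)"
      using SG fin by (simp add: finite_subset[of S "carrier G"] subsetI)
    also have "rep g \<in> rep ` S \<longleftrightarrow> g \<in> S"
    proof
      assume "rep g \<in> rep ` S"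
      then obtain s where s: "s \<in> S" "rep g = rep s" by auto
      then have "g \<in> double_coset G H s"
        using dc_rep[OF g] dc_rep[OF SG] double_coset_self[OF H g] by metis
      then show "g \<in> S" using double_coset_subset[OF S(1) s(1) H] by blast
    qed blast
    finally show "adjacency_matrix \<Gamma> X Y = (\<Sum>d\<in>rep ` S. orbital_matrix G H d X Y)"
      using arcs[of x y] xy by (simp add: adjacency_matrix_def g_def)
  qed
qed

text \<open>\<open>N\<close> stands for the product of the centre with \<open>H\<close>. Centrality
  of \<open>z\<close> and \<open>z \<otimes> z \<in> H\<close> make translation by \<open>z\<close>
  an involution on the cosets; \<open>z \<in> N\<close> keeps it inside blocks and
  \<open>z \<notin> H\<close> excludes fixed points. The element \<open>w\<close> provides a second
  block.\<close>

theorem orbital_scheme_pst: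
  assumes fin: "finite (carrier G)" and H: "subgroup H G" and N: "subgroup N G" "H \<subseteq> N"
    and w: "w \<in> carrier G" "w \<notin> N"
    and z: "z \<in> N" "z \<notin> H" "z \<otimes> z \<in> H" "\<And>g. g \<in> carrier G \<Longrightarrow> z \<otimes> g = g \<otimes> z"
    and index: "4 dvd card ((\<lambda>x. x <# H) ` N)"
  shows "\<exists>\<Gamma>. belongs_to_orbital_scheme \<Gamma> G H \<and> Digraph_Component.connected (with_proj \<Gamma>) \<and>
    admits_perfect_state_transfer \<Gamma> \<and> \<not> disjoint_union_of_K2s (graph_complement \<Gamma>)"
proof -
  have HG: "h \<in> carrier G" if "h \<in> H" for h using that subgroup.mem_carrier[OF H] by blast
  have NG: "h \<in> carrier G" if "h \<in> N" for h using that subgroup.mem_carrier[OF N(1)] by blast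
  have zG: "z \<in> carrier G" using z NG by blast
  define V where "V = lcosets H"
  define R where "R = {(x <# H, y <# H) | x y. x \<in> carrier G \<and> y \<in> carrier G \<and> inv x \<otimes> y \<in> N}"
  define t where "t X = X #> z" for X
  have bN: "bi_invariant H N"
    using N(2) NG subgroup.m_closed[OF N(1)] unfolding bi_invariant_def by blast
  have R: "(x <# H, y <# H) \<in> R \<longleftrightarrow> inv x \<otimes> y \<in> N" if "x \<in> carrier G" "y \<in> carrier G" for x y
    unfolding R_def using lcoset_rep_indep[OF H bN] that by blast
  have V: "X \<in> V \<longleftrightarrow> (\<exists>x\<in>carrier G. X = x <# H)" for X
    by (auto simp: V_def LCOSETS_def)
  \<comment> \<open>Translating a left coset by \<open>z\<close> on the right gives a left coset
    again because \<open>z\<close> commutes with \<open>H\<close>.\<close>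
  have t: "t (x <# H) = (x \<otimes> z) <# H" if "x \<in> carrier G" for x
  proof -
    have "x \<otimes> h \<otimes> z = x \<otimes> z \<otimes> h" if "h \<in> H" for h
      using z(4)[OF HG[OF that]] that HG zG \<open>x \<in> carrier G\<close> by (simp add: m_assoc)
    then show ?thesis by (auto simp: t_def l_coset_def r_coset_def)
  qed
  \<comment> \<open>The block of \<open>x <# H\<close> is the translate by \<open>x\<close> of the
    cosets of \<open>H\<close> in \<open>N\<close>, so all blocks have the same size.\<close>
  have R_class: "R `` {x <# H} = (\<lambda>n. (x \<otimes> n) <# H) ` N" if x: "x \<in> carrier G" for x
  proof (intro equalityI subsetI)
    fix Y assume Y: "Y \<in> R `` {x <# H}"
    then obtain y where y: "y \<in> carrier G" "Y = y <# H" by (auto simp: R_def)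
    have "inv x \<otimes> y \<in> N" using Y y R[OF x y(1)] by auto
    moreover have "y = x \<otimes> (inv x \<otimes> y)" using x y by (simp add: m_assoc[symmetric])
    ultimately show "Y \<in> (\<lambda>n. (x \<otimes> n) <# H) ` N"
      using y(2) by (metis image_eqI)
  next
    fix Y assume "Y \<in> (\<lambda>n. (x \<otimes> n) <# H) ` N"
    then obtain n where n: "n \<in> N" "Y = (x \<otimes> n) <# H" by auto
    then have "inv x \<otimes> (x \<otimes> n) = n" using x NG by (simp add: m_assoc[symmetric])
    then show "Y \<in> R `` {x <# H}" using R[of x "x \<otimes> n"] n x NG by auto
  qed
  define m where "m = card ((\<lambda>x. x <# H) ` N)"
  have "equiv V R"
  proof (rule equivI)
    show "R \<subseteq> V \<times> V" by (auto simp: R_def V)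
    show "refl_on V R"
      using R subgroup.one_closed[OF N(1)] by (auto simp: refl_on_def V)
    show "sym R"
    proof (rule symI)
      fix X Y assume "(X, Y) \<in> R"
      then obtain x y where xy: "X = x <# H" "Y = y <# H" "x \<in> carrier G" "y \<in> carrier G"
        "inv x \<otimes> y \<in> N" by (auto simp: R_def)
      have "inv (inv x \<otimes> y) \<in> N" using xy subgroup.m_inv_closed[OF N(1)] by blast
      then show "(Y, X) \<in> R" using xy R by (simp add: inv_mult_group)
    qed
    show "trans R"
    proof (rule transI)
      fix X Y Z assume a: "(X, Y) \<in> R" "(Y, Z) \<in> R"
      then obtain x y z where xyz: "X = x <# H" "Y = y <# H" "Z = z <# H"
        "x \<in> carrier G" "y \<in> carrier G" "z \<in> carrier G"
        by (auto simp: R_def)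
      then have "(inv x \<otimes> y) \<otimes> (inv y \<otimes> z) \<in> N"
        using a R subgroup.m_closed[OF N(1)] by auto
      also have "(inv x \<otimes> y) \<otimes> (inv y \<otimes> z) = inv x \<otimes> z"
        using xyz by (metis inv_closed inv_solve_left m_assoc m_closed)
      finally show "(X, Z) \<in> R" using xyz R by simp
    qed
  qed
  interpret block_involution V R t m
  proof
    show "finite V"
      using fin by (simp add: V_def LCOSETS_def)
    show "equiv V R" by fact
  next
    fix X assume "X \<in> V"
    then obtain x where x: "x \<in> carrier G" "X = x <# H" using V by blast
    have eq: "(x \<otimes> n) <# H = (x \<otimes> n') <# H \<longleftrightarrow> n <# H = n' <# H" if "n \<in> N" "n' \<in> N" for n n'
    proof -
      have "inv (x \<otimes> n) \<otimes> (x \<otimes> n') = inv n \<otimes> n'"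
        using that NG x by (simp add: inv_mult_group m_assoc) (simp add: m_assoc[symmetric])
      then show ?thesis using that NG x by (simp add: lcoset_eq_iff[OF H])
    qed
    have "bij_betw (\<lambda>Y. x <#\<^bsub>G\<^esub> Y) ((\<lambda>n. n <# H) ` N) ((\<lambda>n. (x \<otimes> n) <# H) ` N)"
    proof -
      have "x <# (n <# H) = (x \<otimes> n) <# H" if "n \<in> N" for n
        using lcos_m_assoc[OF _ x(1) NG[OF that]] HG by blast
      then show ?thesis using eq by (auto simp: bij_betw_def inj_on_def image_image)
    qed
    then show "card (R `` {X}) = m"
      using bij_betw_same_card R_class[OF x(1)] x(2) by (metis m_def)
    have "inv x \<otimes> (x \<otimes> z) = z" using x zG by (simp add: m_assoc[symmetric])
    then show "(X, t X) \<in> R" "t X \<noteq> X"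
      using x z(1,2) zG t[OF x(1)] R[of x "x \<otimes> z"] lcoset_eq_iff[OF H, of x "x \<otimes> z"] by simp_all
    have "inv x \<otimes> (x \<otimes> z \<otimes> z) = z \<otimes> z" using x zG by (simp add: m_assoc[symmetric])
    then have "(x \<otimes> z \<otimes> z) <# H = x <# H"
      using x(1) zG z(3) lcoset_eq_iff[OF H, of x "x \<otimes> z \<otimes> z"] by simp
    then show "t (t X) = X" using x zG t by simp
  qed
  \<comment> \<open>The connection set: the complement of \<open>N\<close> gives the arcs between
    blocks, and the coset of \<open>z\<close>, itself a double coset by centrality, gives the
    matching.\<close>
  define S where "S = (carrier G - N) \<union> (z <# H)"
  have bS: "bi_invariant H S"
    unfolding bi_invariant_def
  proof (intro conjI ballI)
    show "S \<subseteq> carrier G" using zG HG by (auto simp: S_def l_coset_def)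
    fix h s h' assume a: "h \<in> H" "s \<in> S" "h' \<in> H"
    show "h \<otimes> s \<otimes> h' \<in> S"
    proof (cases "s \<in> z <# H")
      case True
      then obtain k where k: "k \<in> H" "s = z \<otimes> k" by (auto simp: l_coset_def)
      have "h \<otimes> s \<otimes> h' = h \<otimes> z \<otimes> k \<otimes> h'" using k a HG zG by (simp add: m_assoc)
      also have "h \<otimes> z = z \<otimes> h" using z(4)[OF HG[OF a(1)]] by (rule sym)
      also have "z \<otimes> h \<otimes> k \<otimes> h' = z \<otimes> (h \<otimes> k \<otimes> h')" using k a HG zG by (simp add: m_assoc)
      finally show ?thesis
        using k a subgroup.m_closed[OF H] by (auto simp: S_def l_coset_def)
    next
      case False
      then have s: "s \<in> carrier G" "s \<notin> N" using a by (auto simp: S_def)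
      \<comment> \<open>Were the product in \<open>N\<close>, cancelling \<open>h\<close> and
        \<open>h'\<close>, which lie in \<open>N\<close>, would put \<open>s\<close> in
        \<open>N\<close>.\<close>
      have "s = inv h \<otimes> (h \<otimes> s \<otimes> h') \<otimes> inv h'"
        using s a HG by (simp add: m_assoc) (simp add: m_assoc[symmetric])
      then have "h \<otimes> s \<otimes> h' \<notin> N"
        using s a N subgroup.m_inv_closed[OF N(1)] subgroup.m_closed[OF N(1)] by (metis subsetD)
      then show ?thesis using s a HG by (simp add: S_def)
    qed
  qed
  have "S \<inter> H = {}"
  proof -
    have False if "h \<in> H" "z \<otimes> h \<in> H" for h
    proof -
      have "(z \<otimes> h) \<otimes> inv h \<in> H"
        using that subgroup.m_closed[OF H] subgroup.m_inv_closed[OF H] by blast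
      then show False using that HG zG z(2) by (simp add: m_assoc)
    qed
    then show ?thesis using N by (auto simp: S_def l_coset_def)
  qed
  have inv_S: "inv s \<in> S" if "s \<in> S" for s
  proof (cases "s \<in> z <# H")
    case True
    then obtain k where k: "k \<in> H" "s = z \<otimes> k" by (auto simp: l_coset_def)
    have k': "inv (z \<otimes> z) \<otimes> inv k \<in> H"
      using k z(3) subgroup.m_closed[OF H] subgroup.m_inv_closed[OF H] by blast
    \<comment> \<open>Here \<open>z \<otimes> z \<in> H\<close> enters: the inverse of
      \<open>z\<close> is \<open>z\<close> times an element of \<open>H\<close>, so the coset of
      \<open>z\<close> is closed under inversion.\<close>
    have "z \<otimes> (inv (z \<otimes> z) \<otimes> inv k) = (z \<otimes> inv z) \<otimes> inv z \<otimes> inv k"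
      using k HG zG by (simp add: m_assoc inv_mult_group) (simp add: m_assoc[symmetric])
    also have "\<dots> = inv (k \<otimes> z)" using k HG zG by (simp add: inv_mult_group)
    also have "\<dots> = inv s" using k z(4)[OF HG[OF k(1)]] by simp
    finally show ?thesis using k' by (force simp: S_def l_coset_def)
  next
    case False
    then have s: "s \<in> carrier G" "s \<notin> N" using that by (auto simp: S_def)
    then have "inv s \<notin> N" using subgroup.m_inv_closed[OF N(1)] by fastforce
    then show ?thesis using s by (simp add: S_def)
  qed
  have arcs: "(x <# H, y <# H) \<in> parcs block_graph \<longleftrightarrow> inv x \<otimes> y \<in> S"
    if "x \<in> carrier G" "y \<in> carrier G" for x y
  proof -
    have "y <# H = (x \<otimes> z) <# H \<longleftrightarrow> inv (x \<otimes> z) \<otimes> y \<in> H"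
      using that zG lcoset_eq_iff[OF H, of "x \<otimes> z" y] by auto
    also have "inv (x \<otimes> z) \<otimes> y = inv z \<otimes> (inv x \<otimes> y)"
      using that zG by (simp add: inv_mult_group m_assoc)
    also have "\<dots> \<in> H \<longleftrightarrow> inv x \<otimes> y \<in> z <# H"
      using subgroup.lcos_module_imp[OF H group_axioms zG]
        subgroup.lcos_module_rev[OF H group_axioms zG] that by blast
    finally show ?thesis
      using that by (auto simp: parcs_block_graph R t S_def V)
  qed
  have one: "H \<in> V" using V lcos_mult_one HG by (metis one_closed subsetI)
  have "pverts block_graph = lcosets H"
    by (rule trans[OF pverts_block_graph V_def])
  from belongs_to_orbital_schemeI[OF fin H bS \<open>S \<inter> H = {}\<close> inv_S pair_graph_block_graph this arcs]
  have "belongs_to_orbital_scheme block_graph G H" .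
  moreover have "Digraph_Component.connected (with_proj block_graph)"
    using connected_block_graph[of "\<one> <# H" "w <# H"] R[of \<one> w] w V by auto
  moreover have "admits_perfect_state_transfer block_graph"
    unfolding admits_perfect_state_transfer_def
    using perfect_state_transfer_block_graph[OF one] index t_in_V[OF one] t_neq[OF one] one
    by (metis m_def pverts_block_graph pi_half_gt_zero)
  \<comment> \<open>Since 4 also divides 0, positivity is what turns divisibility into
    \<open>4 \<le> m\<close>.\<close>
  moreover have "m > 0"
    using N(1) fin NG subgroup.one_closed[OF N(1)]
    by (auto simp: m_def card_gt_0_iff intro: finite_subset[of N "carrier G"])
  then have "4 \<le> m" using index dvd_imp_le by (simp add: m_def)
  then have "\<not> disjoint_union_of_K2s (graph_complement block_graph)"
    using complement_not_K2s[OF one] by blast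
  ultimately show ?thesis by blast
qed

end

section \<open>Quadratic extensions and general linear groups\<close>

context
  fixes K :: "'a::field set"
  assumes K: "is_subfield K"
begin

lemma subfield_0: "0 \<in> K" and subfield_1: "1 \<in> K"
  using K by (auto simp: is_subfield_def)

lemma subfield_add: "x \<in> K \<Longrightarrow> y \<in> K \<Longrightarrow> x + y \<in> K"
  and subfield_mult: "x \<in> K \<Longrightarrow> y \<in> K \<Longrightarrow> x * y \<in> K"
  and subfield_uminus: "x \<in> K \<Longrightarrow> - x \<in> K"
  and subfield_inverse: "x \<in> K \<Longrightarrow> inverse x \<in> K"
  using K by (auto simp: is_subfield_def)

lemma subfield_diff: "x \<in> K \<Longrightarrow> y \<in> K \<Longrightarrow> x - y \<in> K"
  using subfield_add[of x "- y"] subfield_uminus by simp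

lemma subfield_divide: "x \<in> K \<Longrightarrow> y \<in> K \<Longrightarrow> x / y \<in> K"
  by (simp add: divide_inverse subfield_mult subfield_inverse)

lemma subfield_of_nat: "of_nat n \<in> K"
  by (induction n) (auto intro: subfield_0 subfield_1 subfield_add)

text \<open>Linear independence of 1 and \<open>w\<close> over \<open>K\<close>: a nontrivial
  relation would express \<open>w\<close> as a quotient of elements of \<open>K\<close>.\<close>

lemma subfield_linear_inj:
  assumes "w \<notin> K" "x \<in> K" "y \<in> K" "x' \<in> K" "y' \<in> K" "x + y * w = x' + y' * w"
  shows "x = x' \<and> y = y'"
proof -
  have *: "(y - y') * w = x' - x" using assms(6) by (simp add: algebra_simps)
  have "y = y'"
  proof (rule ccontr)
    assume "y \<noteq> y'"
    with * have "w = (x' - x) / (y - y')" by (simp add: field_simps)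
    then show False using assms by (simp add: subfield_diff subfield_divide)
  qed
  then show ?thesis using * by simp
qed

end

text \<open>Translation by 1 permutes \<open>K\<close>, so the sum of its elements does not change
  when \<open>card K\<close> ones are added to it. This serves to exclude characteristic 2 when
  \<open>card K\<close> is odd.\<close>

lemma of_nat_card_subfield:
  fixes K :: "'a::{field, finite} set"
  assumes "is_subfield K"
  shows "of_nat (card K) = (0 :: 'a)"
proof -
  have "(\<Sum>x\<in>K. x) = (\<Sum>x\<in>K. x + 1)"
    by (rule sum.reindex_bij_witness[of _ "\<lambda>x. x + 1" "\<lambda>x. x - 1"])
      (auto intro: subfield_add subfield_diff subfield_1 assms)
  then show ?thesis by (simp add: sum.distrib)
qed

text \<open>Completing the square in the quadratic equation of any element outside \<open>K\<close>.\<close>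

lemma quadratic_extension_generator:
  fixes K :: "'a::{field, finite} set"
  assumes K: "is_subfield K" and odd: "odd (card K)" and card: "CARD('a) = card K ^ 2" "card K > 1"
  obtains \<zeta> where "\<zeta> \<notin> K" "\<zeta> * \<zeta> \<in> K" "\<And>c. \<exists>x\<in>K. \<exists>y\<in>K. c = x + y * \<zeta>"
proof -
  have two: "(2 :: 'a) \<noteq> 0"
  proof
    assume "(2 :: 'a) = 0"
    moreover obtain k where "card K = 2 * k + 1" using odd by (elim oddE)
    ultimately show False using of_nat_card_subfield[OF K] by simp
  qed
  have "card K < CARD('a)" using card by (simp add: power2_eq_square)
  then obtain w where w: "w \<notin> K" by (metis UNIV_eq_I less_irrefl)
  \<comment> \<open>An injection of the pairs over \<open>K\<close> into a field of the same
    cardinality is onto, so 1 and \<open>w\<close> form a basis.\<close>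
  have "inj_on (\<lambda>(x, y). x + y * w) (K \<times> K)"
    using subfield_linear_inj[OF K w] by (auto intro!: inj_onI)
  then have "card ((\<lambda>(x, y). x + y * w) ` (K \<times> K)) = CARD('a)"
    by (simp add: card_image card_cartesian_product card power2_eq_square)
  then have surj: "(\<lambda>(x, y). x + y * w) ` (K \<times> K) = UNIV"
    by (intro card_subset_eq) auto
  have span: "\<exists>x\<in>K. \<exists>y\<in>K. c = x + y * w" for c
  proof -
    have "c \<in> (\<lambda>(x, y). x + y * w) ` (K \<times> K)" unfolding surj by simp
    then show ?thesis by auto
  qed
  obtain a b where ab: "b \<in> K" "a \<in> K" "w * w = b + a * w" using span by blast
  \<comment> \<open>From w^2 = b + 2ew the shifted element w - e has square b + e^2, which lies in
    \<open>K\<close>.\<close>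
  define e where "e = a / 2"
  have e: "e \<in> K" "a = 2 * e"
    using subfield_divide[OF K ab(2) subfield_of_nat[OF K, of 2]] two by (simp_all add: e_def)
  show ?thesis
  proof
    show "w - e \<notin> K" using subfield_add[OF K _ e(1), of "w - e"] w by auto
    have "(w - e) * (w - e) = b + e * e"
      using ab(3) e(2) by (simp add: algebra_simps)
    then show "(w - e) * (w - e) \<in> K"
      using ab(1) e(1) by (simp add: subfield_add[OF K] subfield_mult[OF K])
    fix c
    obtain x y where xy: "x \<in> K" "y \<in> K" "c = x + y * w" using span by blast
    then have "c = (x + y * e) + y * (w - e)" by (simp add: algebra_simps)
    then show "\<exists>x\<in>K. \<exists>y\<in>K. c = x + y * (w - e)"
      using xy e(1) subfield_add[OF K] subfield_mult[OF K] by blast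
  qed
qed

section \<open>Scalar matrices and the groups of invertible matrices\<close>

lemma mat_mult_nth: "(mat c ** A) $ i $ j = c * (A :: 'a::field^2^2) $ i $ j"
  by (simp add: matrix_matrix_mult_def mat_def if_distrib[of "\<lambda>x. x * _"] cong: if_cong)

lemma mult_mat_nth: "((A :: 'a::field^2^2) ** mat c) $ i $ j = c * A $ i $ j"
  by (simp add: matrix_matrix_mult_def mat_def if_distrib[of "\<lambda>x. _ * x"] mult.commute cong: if_cong)

lemma mat_mult_commute: "mat c ** (A :: 'a::field^2^2) = A ** mat c"
  by (simp add: vec_eq_iff mat_mult_nth mult_mat_nth)

lemma mat_mult_mat: "mat c ** mat d = (mat (c * d) :: 'a::field^2^2)"
  by (simp add: vec_eq_iff mat_mult_nth) (simp add: mat_def)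

lemma matrix_mult_inverses:
  fixes A B A' B' :: "'a::field^2^2"
  assumes "A ** A' = mat 1" "B ** B' = mat 1"
  shows "(A ** B) ** (B' ** A') = mat 1"
proof -
  have "(A ** B) ** (B' ** A') = A ** (B ** B') ** A'" by (simp only: matrix_mul_assoc)
  then show ?thesis using assms by simp
qed

lemma GL2_simps [simp]:
  "monoid.mult (GL2 K) = (**)" "one (GL2 K) = mat 1"
  by (simp_all add: GL2_def)

lemma carrier_GL2:
  "A \<in> carrier (GL2 K) \<longleftrightarrow>
    A \<in> mat2_over K \<and> (\<exists>B \<in> mat2_over K. A ** B = mat 1 \<and> B ** A = mat 1)"
  by (simp add: GL2_def)

lemma group_GL2_UNIV: "group (GL2 (UNIV :: 'a::field set))"
proof (rule groupI)
  fix A B :: "'a^2^2"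
  assume "A \<in> carrier (GL2 UNIV)" "B \<in> carrier (GL2 UNIV)"
  then obtain A' B' where "A ** A' = mat 1" "A' ** A = mat 1" "B ** B' = mat 1" "B' ** B = mat 1"
    by (auto simp: carrier_GL2)
  then have "(A ** B) ** (B' ** A') = mat 1" "(B' ** A') ** (A ** B) = mat 1"
    by (simp_all only: matrix_mult_inverses)
  then show "A \<otimes>\<^bsub>GL2 UNIV\<^esub> B \<in> carrier (GL2 UNIV)"
    by (auto simp: carrier_GL2 mat2_over_def)
next
  show "\<one>\<^bsub>GL2 UNIV\<^esub> \<in> carrier (GL2 (UNIV :: 'a set))"
    by (auto simp: carrier_GL2 mat2_over_def intro!: exI[of _ "mat 1"])
next
  fix A :: "'a^2^2"
  assume "A \<in> carrier (GL2 UNIV)"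
  then obtain B where "A ** B = mat 1" "B ** A = mat 1"
    by (auto simp: carrier_GL2)
  then show "\<exists>B\<in>carrier (GL2 UNIV). B \<otimes>\<^bsub>GL2 UNIV\<^esub> A = \<one>\<^bsub>GL2 UNIV\<^esub>"
    by (intro bexI[of _ B]) (auto simp: carrier_GL2 mat2_over_def)
qed (auto simp: matrix_mul_assoc)

lemma inv_GL2:
  assumes "A ** B = mat 1" "B ** A = (mat 1 :: 'a::field^2^2)"
  shows "inv\<^bsub>GL2 UNIV\<^esub> A = B"
proof -
  interpret group "GL2 (UNIV :: 'a set)" by (rule group_GL2_UNIV)
  show ?thesis
    using assms by (intro inv_equality) (auto simp: carrier_GL2 mat2_over_def)
qed

context
  fixes K :: "'a::field set"
  assumes K: "is_subfield K"
begin

lemma mat2_over_mult: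
  assumes "A \<in> mat2_over K" "B \<in> mat2_over K"
  shows "A ** B \<in> mat2_over K"
  using assms
  by (auto simp: mat2_over_def matrix_matrix_mult_def sum_2 intro!: subfield_add[OF K] subfield_mult[OF K])

lemma mat2_over_mat: "mat c \<in> mat2_over K \<longleftrightarrow> c \<in> K"
  using subfield_0[OF K] by (auto simp: mat2_over_def mat_def)

text \<open>Closure under inversion rests on \<open>GL2 K\<close> requiring an inverse over
  \<open>K\<close>; by uniqueness it is the inverse in the large group.\<close>

lemma subgroup_GL2: "subgroup (carrier (GL2 K)) (GL2 UNIV)"
proof -
  interpret group "GL2 (UNIV :: 'a set)" by (rule group_GL2_UNIV)
  show ?thesis
  proof (rule subgroupI)
    show "carrier (GL2 K) \<subseteq> carrier (GL2 UNIV)"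
      by (auto simp: carrier_GL2 mat2_over_def)
    have "mat 1 \<in> carrier (GL2 K)"
      using subfield_1[OF K] mat2_over_mat by (auto simp: carrier_GL2 intro!: bexI[of _ "mat 1"])
    then show "carrier (GL2 K) \<noteq> {}" by blast
  next
    fix A assume "A \<in> carrier (GL2 K)"
    then obtain B where "A \<in> mat2_over K" "B \<in> mat2_over K" "A ** B = mat 1" "B ** A = mat 1"
      by (auto simp: carrier_GL2)
    then show "inv\<^bsub>GL2 UNIV\<^esub> A \<in> carrier (GL2 K)"
      by (auto simp: inv_GL2 carrier_GL2)
  next
    fix A B assume "A \<in> carrier (GL2 K)" "B \<in> carrier (GL2 K)"
    then obtain A' B' where *: "A \<in> mat2_over K" "B \<in> mat2_over K"
      "A' \<in> mat2_over K" "B' \<in> mat2_over K"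
      "A ** A' = mat 1" "A' ** A = mat 1" "B ** B' = mat 1" "B' ** B = mat 1"
      by (auto simp: carrier_GL2)
    then have "(A ** B) ** (B' ** A') = mat 1" "(B' ** A') ** (A ** B) = mat 1"
      by (simp_all only: matrix_mult_inverses)
    then show "A \<otimes>\<^bsub>GL2 UNIV\<^esub> B \<in> carrier (GL2 K)"
      using * mat2_over_mult by (auto simp: carrier_GL2)
  qed
qed

lemma mat_in_GL2: "mat c \<in> carrier (GL2 K) \<longleftrightarrow> c \<in> K \<and> c \<noteq> 0"
proof
  assume "mat c \<in> carrier (GL2 K)"
  then obtain B :: "'a^2^2" where "mat c ** B = mat 1" "c \<in> K"
    by (auto simp: carrier_GL2 mat2_over_mat)
  then have "(mat c ** B) $ 1 $ 1 = 1" by (simp add: mat_def)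
  then have "c * B $ 1 $ 1 = 1" by (simp only: mat_mult_nth)
  then show "c \<in> K \<and> c \<noteq> 0" using \<open>c \<in> K\<close> by auto
next
  assume "c \<in> K \<and> c \<noteq> 0"
  then show "mat c \<in> carrier (GL2 K)"
    using subfield_inverse[OF K]
    by (auto simp: carrier_GL2 mat2_over_mat mat_mult_mat intro!: bexI[of _ "mat (inverse c)"])
qed

end

lemma is_subfield_UNIV: "is_subfield (UNIV :: 'a::field set)"
  by (simp add: is_subfield_def)

section \<open>The case of GL(2,q^2) and GL(2,q)\<close>

theorem theorem1p3:
  fixes q :: nat and K :: "'a::{field, finite} set"
  assumes "primepow q"
    and "[q = 3] (mod 4)"
    and "CARD('a) = q ^ 2"
    and "is_subfield K"
    and "card K = q"
  shows "\<exists>\<Gamma> :: ('a^2^2) set pair_pre_digraph.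
           belongs_to_orbital_scheme \<Gamma> (GL2 (UNIV :: 'a set)) (carrier (GL2 K)) \<and>
           Digraph_Component.connected (with_proj \<Gamma>) \<and>
           admits_perfect_state_transfer \<Gamma> \<and>
           \<not> disjoint_union_of_K2s (graph_complement \<Gamma>)"
proof -
  note K = \<open>is_subfield K\<close>
  note sub = subfield_0[OF K] subfield_1[OF K] subfield_add[OF K] subfield_mult[OF K]
    subfield_diff[OF K] subfield_divide[OF K]
  have q: "4 dvd q + 1" "odd q" "q > 1"
    using assms(2) unfolding cong_def by presburger+
  obtain \<zeta> where \<zeta>: "\<zeta> \<notin> K" "\<zeta> * \<zeta> \<in> K" and span: "\<And>c. \<exists>x\<in>K. \<exists>y\<in>K. c = x + y * \<zeta>"
    using quadratic_extension_generator[OF K] q assms(3,5) by metis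
  have "\<zeta> \<noteq> 0" using \<zeta>(1) sub(1) by auto
  define G where "G = GL2 (UNIV :: 'a set)"
  define H where "H = carrier (GL2 K)"
  interpret group G unfolding G_def by (rule group_GL2_UNIV)
  have G [simp]: "x \<otimes>\<^bsub>G\<^esub> y = x ** y" "\<one>\<^bsub>G\<^esub> = mat 1" for x y
    by (simp_all add: G_def)
  have H: "subgroup H G" unfolding G_def H_def by (rule subgroup_GL2[OF K])
  have HG: "h \<in> carrier G" if "h \<in> H" for h using that subgroup.mem_carrier[OF H] by blast
  have mat_H: "mat c \<in> H \<longleftrightarrow> c \<in> K \<and> c \<noteq> 0" for c
    unfolding H_def by (rule mat_in_GL2[OF K])
  have mat_G: "mat c \<in> carrier G \<longleftrightarrow> c \<noteq> 0" for c
    unfolding G_def using mat_in_GL2[OF is_subfield_UNIV] by simp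
  have inv_mat: "inv\<^bsub>G\<^esub> (mat c) = mat (inverse c)" if "c \<noteq> 0" for c
    unfolding G_def using that by (intro inv_GL2) (simp_all add: mat_mult_mat)
  \<comment> \<open>The product of the scalar matrices with \<open>H\<close>, a subgroup because
    scalars are central.\<close>
  define N where "N = {mat c ** h | c h. c \<noteq> 0 \<and> h \<in> H}"
  have HN: "H \<subseteq> N"
  proof
    fix h assume "h \<in> H"
    moreover have "h = mat 1 ** h" by simp
    ultimately show "h \<in> N" unfolding N_def using one_neq_zero by blast
  qed
  have N: "subgroup N G"
  proof (rule subgroupI)
    show "N \<subseteq> carrier G"
      using m_closed mat_G HG by (auto simp: N_def)
    show "N \<noteq> {}" using subgroup.one_closed[OF H] HN by blast
  next
    fix a assume "a \<in> N"
    then obtain c h where c: "a = mat c ** h" "c \<noteq> 0" "h \<in> H" by (auto simp: N_def)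
    then have "inv\<^bsub>G\<^esub> a = inv\<^bsub>G\<^esub> h ** mat (inverse c)"
      using inv_mult_group[of "mat c" h] mat_G HG inv_mat by simp
    then have "inv\<^bsub>G\<^esub> a = mat (inverse c) ** inv\<^bsub>G\<^esub> h"
      by (simp add: mat_mult_commute)
    then show "inv\<^bsub>G\<^esub> a \<in> N"
      using c subgroup.m_inv_closed[OF H] unfolding N_def by force
  next
    fix a b assume "a \<in> N" "b \<in> N"
    then obtain c h d k where c: "a = mat c ** h" "c \<noteq> 0" "h \<in> H" "b = mat d ** k" "d \<noteq> 0" "k \<in> H"
      by (auto simp: N_def)
    have "a ** b = mat c ** (h ** mat d) ** k"
      unfolding c by (simp only: matrix_mul_assoc)
    also have "h ** mat d = mat d ** h" by (rule mat_mult_commute[symmetric])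
    also have "mat c ** (mat d ** h) ** k = mat c ** mat d ** (h ** k)"
      by (simp only: matrix_mul_assoc)
    finally have "a ** b = mat (c * d) ** (h ** k)" by (simp only: mat_mult_mat)
    moreover have "h ** k \<in> H" using c subgroup.m_closed[OF H] by auto
    ultimately show "a \<otimes>\<^bsub>G\<^esub> b \<in> N"
      using c unfolding N_def by force
  qed
  \<comment> \<open>A unipotent upper triangular matrix, with inverse \<open>w'\<close>. Quotients
    of entries of a matrix in \<open>N\<close> lie in \<open>K\<close>, whereas here the first row
    has the quotient \<open>\<zeta>\<close>.\<close>
  define w :: "'a^2^2" where
    "w = (\<chi> i j. if i = j then 1 else if i = 1 then \<zeta> else 0)"
  define w' :: "'a^2^2" where
    "w' = (\<chi> i j. if i = j then 1 else if i = 1 then - \<zeta> else 0)"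
  have "w ** w' = mat 1" "w' ** w = mat 1"
    by (simp_all add: w_def w'_def vec_eq_iff matrix_matrix_mult_def sum_2 forall_2 mat_def)
  then have w: "w \<in> carrier G" by (auto simp: G_def carrier_GL2 mat2_over_def)
  have "w \<notin> N"
  proof
    assume "w \<in> N"
    then obtain c h where c: "w = mat c ** h" "h \<in> H" by (auto simp: N_def)
    then have h: "h $ i $ j \<in> K" for i j by (auto simp: H_def carrier_GL2 mat2_over_def)
    have "w $ 1 $ 1 = 1" "w $ 1 $ 2 = \<zeta>" by (simp_all add: w_def)
    then have e: "c * h $ 1 $ 1 = 1" "\<zeta> = c * h $ 1 $ 2"
      by (simp_all add: c mat_mult_nth)
    then have "h $ 1 $ 1 \<noteq> 0" by auto
    moreover have "\<zeta> * h $ 1 $ 1 = (c * h $ 1 $ 1) * h $ 1 $ 2"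
      unfolding e(2) by (simp only: ac_simps)
    ultimately have "\<zeta> = h $ 1 $ 2 / h $ 1 $ 1" using e(1) by (simp add: nonzero_eq_divide_eq)
    then show False using h sub \<zeta>(1) by metis
  qed
  \<comment> \<open>Cosets of \<open>H\<close> in \<open>N\<close> correspond to nonzero scalars
    modulo those of \<open>K\<close>, that is, to points of the projective line over
    \<open>K\<close>. \<open>C\<close> has one scalar for each of the q + 1 points, with 1 as the
    point at infinity.\<close>
  define C where "C = insert 1 ((\<lambda>k. \<zeta> + k) ` K)"
  have C_notin: "\<zeta> + k \<notin> K" if "k \<in> K" for k
    using sub(5)[of "\<zeta> + k" k] that \<zeta>(1) by auto
  have C0: "c \<noteq> 0" if "c \<in> C" for c
    using that C_notin sub(1) by (auto simp: C_def) (metis)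
  have coset_iff: "mat c <#\<^bsub>G\<^esub> H = mat d <#\<^bsub>G\<^esub> H \<longleftrightarrow> d / c \<in> K" if "c \<noteq> 0" "d \<noteq> 0" for c d
    using that lcoset_eq_iff[OF H, of "mat c" "mat d"]
    by (simp add: mat_G inv_mat mat_mult_mat mat_H divide_inverse mult.commute)
  have ratio: "c = d" if cd: "c \<in> C" "d \<in> C" "d / c \<in> K" for c d
  proof -
    have "c / d \<in> K" using sub(6)[OF sub(2) cd(3)] C0 cd by simp
    consider "c = 1" "d = 1" | k where "c = 1" "d = \<zeta> + k" "k \<in> K" | k where "d = 1" "c = \<zeta> + k" "k \<in> K"
      | k l where "c = \<zeta> + k" "d = \<zeta> + l" "k \<in> K" "l \<in> K"
      using cd by (auto simp: C_def)
    then show ?thesis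
    proof cases
      case 4
      define r where "r = d / c"
      have "d = r * c" using C0[OF cd(1)] by (simp add: r_def)
      \<comment> \<open>Comparing the coefficients of \<open>\<zeta>\<close> forces the ratio
        \<open>r\<close> to be 1.\<close>
      then have "l + 1 * \<zeta> = r * k + r * \<zeta>" using 4 by (simp add: algebra_simps)
      then have "r = 1" using subfield_linear_inj[OF K \<zeta>(1)] 4 sub cd(3) r_def by metis
      then show ?thesis using \<open>d = r * c\<close> by simp
    qed (use C_notin cd(3) \<open>c / d \<in> K\<close> in auto)
  qed
  have "(\<lambda>x. x <#\<^bsub>G\<^esub> H) ` N = (\<lambda>c. mat c <#\<^bsub>G\<^esub> H) ` C"
  proof (intro equalityI subsetI)
    fix X assume "X \<in> (\<lambda>x. x <#\<^bsub>G\<^esub> H) ` N"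
    then obtain c h where c: "X = (mat c ** h) <#\<^bsub>G\<^esub> H" "c \<noteq> 0" "h \<in> H" by (auto simp: N_def)
    then have X: "X = mat c <#\<^bsub>G\<^esub> H"
      using lcos_m_assoc[of H "mat c" h] HG mat_G coset_join3[OF _ H] by force
    obtain x y where xy: "x \<in> K" "y \<in> K" "c = x + y * \<zeta>" using span by blast
    \<comment> \<open>Normalise x + y\<zeta> as a projective point: if y = 0 it is in the class of
      1, otherwise dividing by y makes the coefficient of \<open>\<zeta>\<close> equal to 1.\<close>
    have "\<exists>d\<in>C. c / d \<in> K"
    proof (cases "y = 0")
      case True
      then show ?thesis using xy by (auto simp: C_def)
    next
      case False
      then have "c = y * (\<zeta> + x / y)" using xy by (simp add: field_simps)
      moreover have "\<zeta> + x / y \<in> C" using xy sub by (auto simp: C_def)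
      ultimately show ?thesis using xy(2) C0 by (intro bexI[of _ "\<zeta> + x / y"]) auto
    qed
    then show "X \<in> (\<lambda>c. mat c <#\<^bsub>G\<^esub> H) ` C"
      using X coset_iff[OF C0 c(2)] by blast
  next
    fix X assume "X \<in> (\<lambda>c. mat c <#\<^bsub>G\<^esub> H) ` C"
    then obtain c where c: "c \<noteq> 0" "X = mat c <#\<^bsub>G\<^esub> H" using C0 by auto
    have "mat c = mat c ** mat 1" by simp
    moreover have "mat 1 \<in> H" using mat_H sub(2) by simp
    ultimately have "mat c \<in> N" using c(1) unfolding N_def by blast
    then show "X \<in> (\<lambda>x. x <#\<^bsub>G\<^esub> H) ` N" using c by blast
  qed
  moreover have "inj_on (\<lambda>c. mat c <#\<^bsub>G\<^esub> H) C"
    using coset_iff C0 ratio by (intro inj_onI) blast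
  moreover have "card C = q + 1"
  proof -
    have "1 \<notin> (\<lambda>k. \<zeta> + k) ` K" using C_notin sub(2) by (metis imageE)
    then show ?thesis using assms(5) by (simp add: C_def card_image)
  qed
  ultimately have index: "4 dvd card ((\<lambda>x. x <#\<^bsub>G\<^esub> H) ` N)"
    using q(1) by (simp add: card_image)
  have "mat \<zeta> = mat \<zeta> ** mat 1" by simp
  moreover have "mat 1 \<in> H" using mat_H sub(2) by simp
  ultimately have "mat \<zeta> \<in> N" using \<open>\<zeta> \<noteq> 0\<close> unfolding N_def by blast
  moreover have "mat \<zeta> \<notin> H" "mat \<zeta> \<otimes>\<^bsub>G\<^esub> mat \<zeta> \<in> H"
    using \<zeta> \<open>\<zeta> \<noteq> 0\<close> by (simp_all add: mat_mult_mat mat_H)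
  moreover have "mat \<zeta> \<otimes>\<^bsub>G\<^esub> g = g \<otimes>\<^bsub>G\<^esub> mat \<zeta>" for g
    unfolding G by (rule mat_mult_commute)
  moreover have "finite (carrier G)" by simp
  ultimately have "\<exists>\<Gamma>. belongs_to_orbital_scheme \<Gamma> G H \<and>
      Digraph_Component.connected (with_proj \<Gamma>) \<and>
      admits_perfect_state_transfer \<Gamma> \<and> \<not> disjoint_union_of_K2s (graph_complement \<Gamma>)"
    using orbital_scheme_pst[OF _ H N HN w \<open>w \<notin> N\<close> _ _ _ _ index] by blast
  then show ?thesis unfolding G_def H_def .
qed

end
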